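(* Assume that $f$ is Lipschitz differentiable, i.e. $\nabla f$ is Lipschitz continuous with constant $L_f\ge 0$; that the level set $\{x\in\mathbb{R}^n : F(x)\le F(x^0,\epsilon^0)\}$ is bounded; and that for all $k\in\mathbb{N}$ one has $\nabla Q_k(x^k)=\nabla f(x^k)$, $Q_k$ is strongly convex with constant $M>L_f/2$, $M>0$, and $Q_k$ is Lipschitz differentiable (its gradient is Lipschitz continuous) with constant $L>0$. Let $\{(x^k,\epsilon^k)\}$ be generated by the IRL1 algorithm with the smart reweighting update of $\epsilon$. Then the following hold: (i) if $\lim_{k\to\infty}\epsilon_i^k=0$, then $\liminf_{k\to\infty}|x_i^k|>0$; (ii) if $\lim_{k\to\infty}\epsilon_i^k>0$, meaning $\epsilon_i$ is not updated after some iteration $\tilde k$, then $\lim_{k\to\infty}x_i^k=0$; (iii) if $\epsilon_i^k\equiv\epsilon_i^{\tilde k}$ (that is, $\epsilon_i$ is not updated after iteration $\tilde k$: $\epsilon_i^k=\epsilon_i^{\tilde k}$ for all $k\ge\tilde k$), then $$w_i^{\tilde k}\ \ge\ \limsup_{k\to\infty}\frac{|\nabla_i f(x^k)|}{\lambda}\qquad\text{and}\qquad \epsilon_i^{\tilde k}\ \le\ \liminf_{k\to\infty}\Big(\frac{p\lambda}{|\nabla_i f(x^k)|}\Big)^{\frac{1}{1-p}}.$$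
   Context: Let $p\in(0,1)$, $\lambda>0$, $f:\mathbb{R}^n\to\mathbb{R}$ continuously differentiable, $F(x)=f(x)+\lambda\sum_{i=1}^n|x_i|^p$, and for $\epsilon\in\mathbb{R}^n_{++}$ let $F(x,\epsilon)=f(x)+\lambda\sum_{i=1}^n(|x_i|+\epsilon_i)^p$. IRL1 algorithm (iteratively reweighted $\ell_1$) with smart reweighting: given $\mu\in(0,1)$, $x^0\in\mathbb{R}^n$, $\epsilon^0\in\mathbb{R}^n_{++}$, for $k=0,1,2,\dots$ set the weights $w_i^k=w(x_i^k,\epsilon_i^k)=p(|x_i^k|+\epsilon_i^k)^{p-1}$, $i=1,\dots,n$; choose a smooth convex local model $Q_k:\mathbb{R}^n\to\mathbb{R}$ of $f$ at $x^k$; set $x^{k+1}=\arg\min_{x\in\mathbb{R}^n}\{Q_k(x)+\lambda\sum_{i=1}^n w_i^k|x_i|\}$; then choose $\epsilon^{k+1}\in\mathbb{R}^n_{++}$ such that, for each $i$, $\epsilon_i^{k+1}=\epsilon_i^k$ if $x_i^{k+1}=0$, and $\epsilon_i^{k+1}\le\mu\epsilon_i^k$ if $x_i^{k+1}\ne0$.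
   Formalization: In (iii) the weight inequality is proved for w_i^k at every k > k̃, and for w_i^{k̃} itself only when x_i^{k̃} = 0; as stated it can fail when x_i^{k̃} ≠ 0, since w_i^{k̃} is then smaller than the stabilised weight. *)

theory Defs
  imports "HOL-Analysis.Analysis"
begin

definition grad :: "(real^'n \<Rightarrow> real) \<Rightarrow> real^'n \<Rightarrow> real^'n" where
  "grad f x = (THE D. GDERIV f x :> D)"

(* grad is the usual gradient wherever f is differentiable. *)
lemma GDERIV_grad:
  fixes f :: "real^'n \<Rightarrow> real"
  assumes "f differentiable (at x)"
  shows "GDERIV f x :> grad f x"
proof -
  from assms obtain f' where f': "(f has_derivative f') (at x)"
    unfolding differentiable_def by blast
  then have lin: "linear f'"
    by (rule has_derivative_linear)
  define D where "D = (\<Sum>b\<in>Basis. f' b *\<^sub>R b)"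
  have "f' = (\<lambda>h. h \<bullet> D)"
  proof
    fix h
    have "f' h = f' (\<Sum>b\<in>Basis. (h \<bullet> b) *\<^sub>R b)"
      by (simp only: euclidean_representation)
    also have "\<dots> = (\<Sum>b\<in>Basis. (h \<bullet> b) * f' b)"
      by (simp only: linear_sum[OF lin] linear_cmul[OF lin] real_scaleR_def)
    also have "\<dots> = h \<bullet> D"
      by (simp only: D_def inner_sum_right inner_scaleR_right mult.commute)
    finally show "f' h = h \<bullet> D" .
  qed
  with f' have D: "GDERIV f x :> D"
    by (simp only: gderiv_def)
  moreover have "D' = D" if "GDERIV f x :> D'" for D'
  proof -
    from that D have eq: "(\<lambda>h. h \<bullet> D') = (\<lambda>h. h \<bullet> D)"
      unfolding gderiv_def by (rule has_derivative_unique)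
    show ?thesis
      by (rule iffD1[OF vector_eq_ldot]) (rule allI, rule fun_cong[OF eq])
  qed
  ultimately show ?thesis
    unfolding grad_def by (rule theI[of "\<lambda>D. GDERIV f x :> D"])
qed

definition continuously_differentiable :: "(real^'n \<Rightarrow> real) \<Rightarrow> bool" where
  "continuously_differentiable f \<longleftrightarrow>
     (\<forall>x. f differentiable (at x)) \<and> continuous_on UNIV (grad f)"

definition lipschitz_differentiable :: "real \<Rightarrow> (real^'n \<Rightarrow> real) \<Rightarrow> bool" where
  "lipschitz_differentiable L f \<longleftrightarrow>
     (\<forall>x. f differentiable (at x)) \<and> L-lipschitz_on UNIV (grad f)"

(* Normalised so that M = 1 is the modulus of x \<mapsto> norm x ^ 2 / 2. *)
definition strongly_convex :: "real \<Rightarrow> (real^'n \<Rightarrow> real) \<Rightarrow> bool" where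
  "strongly_convex M f \<longleftrightarrow>
     (\<forall>x y. \<forall>t\<in>{0..1}. f ((1 - t) *\<^sub>R x + t *\<^sub>R y)
        \<le> (1 - t) * f x + t * f y - M / 2 * t * (1 - t) * (norm (x - y))\<^sup>2)"

definition lp_objective :: "real \<Rightarrow> real \<Rightarrow> (real^'n \<Rightarrow> real) \<Rightarrow> real^'n \<Rightarrow> real" where
  "lp_objective p lam f x = f x + lam * (\<Sum>i\<in>UNIV. \<bar>x $ i\<bar> powr p)"

definition lp_objective_eps ::
  "real \<Rightarrow> real \<Rightarrow> (real^'n \<Rightarrow> real) \<Rightarrow> real^'n \<Rightarrow> real^'n \<Rightarrow> real" where
  "lp_objective_eps p lam f x e = f x + lam * (\<Sum>i\<in>UNIV. (\<bar>x $ i\<bar> + e $ i) powr p)"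

definition irl1_weight :: "real \<Rightarrow> real^'n \<Rightarrow> real^'n \<Rightarrow> 'n \<Rightarrow> real" where
  "irl1_weight p x e i = p * (\<bar>x $ i\<bar> + e $ i) powr (p - 1)"

(* The pairs (x k, eps k) form a run of IRL1 with smart reweighting and local models Q k.
   The algorithm leaves eps (Suc k) free subject to the stated constraints, so a run is
   described by a predicate. How Q k relates to f at x k is not prescribed here. *)
definition irl1_smart_run ::
  "real \<Rightarrow> real \<Rightarrow> real \<Rightarrow> (nat \<Rightarrow> real^'n \<Rightarrow> real) \<Rightarrow> (nat \<Rightarrow> real^'n) \<Rightarrow> (nat \<Rightarrow> real^'n) \<Rightarrow> bool" where
  "irl1_smart_run p lam mu Q x eps \<longleftrightarrow>
     (\<forall>k i. 0 < eps k $ i) \<and>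
     (\<forall>k. continuously_differentiable (Q k) \<and> convex_on UNIV (Q k)) \<and>
     (\<forall>k. is_arg_min
        (\<lambda>z. Q k z + lam * (\<Sum>i\<in>UNIV. irl1_weight p (x k) (eps k) i * \<bar>z $ i\<bar>))
        (\<lambda>z. True) (x (Suc k))) \<and>
     (\<forall>k i. if x (Suc k) $ i = 0 then eps (Suc k) $ i = eps k $ i
            else eps (Suc k) $ i \<le> mu * eps k $ i)"

(* (p * lam / g) powr (1 / (1 - p)) for g \<ge> 0, with value \<infinity> at g = 0
   (real division would give 0 there). *)
definition eps_threshold :: "real \<Rightarrow> real \<Rightarrow> real \<Rightarrow> ereal" where
  "eps_threshold p lam g = (if g = 0 then \<infinity> else ereal ((p * lam / g) powr (1 / (1 - p))))"

end

theory Submission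
  imports Defs
begin

text \<open>
  Everything rests on two facts about a run and a feedback loop between iterate and smoothing.

  The first fact is that the steps x (Suc k) - x k tend to zero while the iterates stay bounded.
  The smoothed objective decreases by at least (M - Lf/2) times the squared step length, because
  the concave penalty lies below its tangent (which is the weighted l1 norm), strong convexity of
  the model is available at both ends of the step, and f exceeds its linearisation by at most
  Lf/2 times the squared distance (\<open>sufficient_decrease\<close>). Strong convexity is used twice, which is why
  M > Lf/2 suffices instead of M > Lf.

  The second fact is coordinatewise stationarity: at x (Suc k) the i-th partial derivative of the
  model has modulus at most lam times the weight, with equality if the coordinate is nonzero
  (\<open>gradient_le_weight\<close>, \<open>gradient_eq_weight\<close>). Since the model gradient agrees
  with grad f at x k and is Lipschitz, short steps carry this over to grad f, and bounded iterates
  give a uniform bound C on these partial derivatives.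

  The feedback loop concerns the sum of |x i| and eps i. Once it falls below a threshold
  depending on C, the weight exceeds C / lam, so equality in the stationarity condition is
  impossible and the next coordinate is zero. The smart update then leaves eps i alone, so the sum
  is still below the threshold and the coordinate is trapped at zero with eps i constant. Hence
  if eps i tends to zero the sum never falls below the threshold, which is (i). Conversely a positive limit
  of eps i allows only finitely many reductions by the factor mu, and whenever no reduction takes
  place the coordinate is zero; this is (ii). In that regime the weight is constant and the
  stationarity inequality passes to the limit; solving it for eps i gives (iii).
\<close>

section \<open>Restricting a differentiable function to a line\<close>

lemma grad_has_derivative_along_line:
  fixes f :: "real^'n \<Rightarrow> real"
  assumes "f differentiable (at (z + t *\<^sub>R d))"
  shows "((\<lambda>t. f (z + t *\<^sub>R d)) has_real_derivative grad f (z + t *\<^sub>R d) \<bullet> d) (at t)"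
proof -
  have "(f has_derivative (\<lambda>h. h \<bullet> grad f (z + t *\<^sub>R d))) (at (z + t *\<^sub>R d))"
    using GDERIV_grad[OF assms] by (simp add: gderiv_def)
  moreover have "((\<lambda>t. z + t *\<^sub>R d) has_derivative (\<lambda>h. h *\<^sub>R d)) (at t)"
    by (auto intro!: derivative_eq_intros)
  ultimately have "((\<lambda>t. f (z + t *\<^sub>R d)) has_derivative
      (\<lambda>h. (h *\<^sub>R d) \<bullet> grad f (z + t *\<^sub>R d))) (at t)"
    using has_derivative_compose by blast
  moreover have "(\<lambda>h. (h *\<^sub>R d) \<bullet> grad f (z + t *\<^sub>R d)) = (*) (grad f (z + t *\<^sub>R d) \<bullet> d)"
    by (auto simp: inner_commute)
  ultimately show ?thesis
    by (simp add: has_field_derivative_def)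
qed

text \<open>
  The quadratic term disappears in the difference quotient as t tends to 0. It is present because
  the modulus of strong convexity enters with the factor t * (1 - t).
\<close>
lemma derivative_le_of_secant_bound:
  fixes \<phi> :: "real \<Rightarrow> real"
  assumes deriv: "(\<phi> has_real_derivative D) (at 0)"
    and secant: "\<And>t. 0 < t \<Longrightarrow> t \<le> 1 \<Longrightarrow> \<phi> t - \<phi> 0 \<le> t * c + K * t\<^sup>2"
  shows "D \<le> c"
proof (rule tendsto_le[of "at_right 0"])
  have "((\<lambda>t. (\<phi> t - \<phi> 0) / (t - 0)) \<longlongrightarrow> D) (at 0)"
    using deriv unfolding has_field_derivative_iff by simp
  then show "((\<lambda>t. (\<phi> t - \<phi> 0) / t) \<longlongrightarrow> D) (at_right 0)"
    using filterlim_at_split by fastforce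
  show "((\<lambda>t. c + K * t) \<longlongrightarrow> c) (at_right 0)"
    by (auto intro!: tendsto_eq_intros)
  have "(\<phi> t - \<phi> 0) / t \<le> c + K * t" if "0 < t" "t < 1" for t
    using secant[of t] that by (simp add: field_simps power2_eq_square)
  then show "\<forall>\<^sub>F t in at_right 0. (\<phi> t - \<phi> 0) / t \<le> c + K * t"
    unfolding eventually_at_right_field by (intro exI[of _ 1]) auto
qed simp

text \<open>
  Along the segment, subtracting the claimed quadratic from f leaves a function whose derivative
  is nonpositive by Cauchy--Schwarz and the Lipschitz bound.
\<close>
lemma lipschitz_gradient_upper_bound:
  fixes f :: "real^'n \<Rightarrow> real"
  assumes "lipschitz_differentiable C f"
  shows "f y \<le> f z + grad f z \<bullet> (y - z) + C / 2 * (norm (y - z))\<^sup>2"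
proof -
  have diff: "f differentiable (at u)" for u
    using assms by (simp add: lipschitz_differentiable_def)
  have lip: "dist (grad f u) (grad f v) \<le> C * dist u v" for u v
    using assms by (auto simp: lipschitz_differentiable_def lipschitz_on_def)
  define d where "d = y - z"
  define \<psi> where "\<psi> t = f (z + t *\<^sub>R d) - t * (grad f z \<bullet> d) - C / 2 * t\<^sup>2 * (norm d)\<^sup>2" for t
  have "\<psi> 1 \<le> \<psi> 0"
  proof (rule DERIV_nonpos_imp_nonincreasing[where f = \<psi> and a = 0 and b = 1])
    fix t :: real assume t: "0 \<le> t" "t \<le> 1"
    let ?D = "grad f (z + t *\<^sub>R d) \<bullet> d - grad f z \<bullet> d - C * t * (norm d)\<^sup>2"
    have "(\<psi> has_real_derivative ?D) (at t)"
      unfolding \<psi>_def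
      by (rule derivative_eq_intros grad_has_derivative_along_line diff refl | simp)+
    moreover have "(grad f (z + t *\<^sub>R d) - grad f z) \<bullet> d \<le> norm (grad f (z + t *\<^sub>R d) - grad f z) * norm d"
      by (rule norm_cauchy_schwarz)
    moreover have "norm (grad f (z + t *\<^sub>R d) - grad f z) * norm d \<le> (C * (t * norm d)) * norm d"
      using lip[of "z + t *\<^sub>R d" z] t by (intro mult_right_mono) (auto simp: dist_norm)
    ultimately show "\<exists>y. DERIV \<psi> t :> y \<and> y \<le> 0"
      by (intro exI[of _ ?D]) (simp add: inner_diff_left power2_eq_square algebra_simps)
  qed simp
  then show ?thesis
    by (simp add: \<psi>_def d_def)
qed

lemma strongly_convex_gradient_lower_bound:
  fixes q :: "real^'n \<Rightarrow> real"
  assumes "strongly_convex M q" and diff: "q differentiable (at z)"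
  shows "q z + grad q z \<bullet> (y - z) + M / 2 * (norm (y - z))\<^sup>2 \<le> q y"
proof -
  define N where "N = M / 2 * (norm (y - z))\<^sup>2"
  have "((\<lambda>t. q (z + t *\<^sub>R (y - z))) has_real_derivative grad q z \<bullet> (y - z)) (at 0)"
    using grad_has_derivative_along_line[of q z 0] diff by simp
  moreover have "q (z + t *\<^sub>R (y - z)) - q (z + 0 *\<^sub>R (y - z)) \<le> t * (q y - q z - N) + N * t\<^sup>2"
    if "0 < t" "t \<le> 1" for t
  proof -
    have line: "(1 - t) *\<^sub>R z + t *\<^sub>R y = z + t *\<^sub>R (y - z)"
      by (simp add: algebra_simps)
    have N: "M / 2 * t * (1 - t) * (norm (z - y))\<^sup>2 = t * (1 - t) * N"
      unfolding N_def norm_minus_commute[of z y] by (simp only: ac_simps times_divide_eq_left)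
    have "q ((1 - t) *\<^sub>R z + t *\<^sub>R y) \<le> (1 - t) * q z + t * q y - M / 2 * t * (1 - t) * (norm (z - y))\<^sup>2"
      using assms(1) that unfolding strongly_convex_def by auto
    then have "q (z + t *\<^sub>R (y - z)) \<le> (1 - t) * q z + t * q y - t * (1 - t) * N"
      unfolding line N .
    then show ?thesis
      by (simp add: algebra_simps power2_eq_square)
  qed
  ultimately have "grad q z \<bullet> (y - z) \<le> q y - q z - N"
    by (rule derivative_le_of_secant_bound)
  then show ?thesis
    by (simp add: N_def)
qed

section \<open>Optimality for a weighted l1 term\<close>

text \<open>
  Moving from the minimiser z towards y by a fraction t changes h by at most t * (h y - h z),
  by convexity; minimality forces q to compensate, and dividing by t leaves the derivative of q.
  One choice of y gives the coordinatewise optimality conditions, another the descent estimate.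
\<close>
lemma composite_minimizer_variational_inequality:
  fixes q h :: "real^'n \<Rightarrow> real"
  assumes diff: "q differentiable (at z)" and "convex_on UNIV h"
    and min: "\<And>y. q z + h z \<le> q y + h y"
  shows "0 \<le> grad q z \<bullet> (y - z) + h y - h z"
proof -
  have "((\<lambda>t. - q (z + t *\<^sub>R (y - z))) has_real_derivative - (grad q z \<bullet> (y - z))) (at 0)"
    using grad_has_derivative_along_line[of q z 0 "y - z"] diff by (intro DERIV_minus) simp
  moreover have "- q (z + t *\<^sub>R (y - z)) - (- q (z + 0 *\<^sub>R (y - z))) \<le> t * (h y - h z) + 0 * t\<^sup>2"
    if "0 < t" "t \<le> 1" for t
  proof -
    have "h ((1 - t) *\<^sub>R z + t *\<^sub>R y) \<le> (1 - t) * h z + t * h y"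
      using convex_onD[OF assms(2), of t z y] that by simp
    moreover have "(1 - t) *\<^sub>R z + t *\<^sub>R y = z + t *\<^sub>R (y - z)"
      by (simp add: algebra_simps)
    ultimately show ?thesis
      using min[of "z + t *\<^sub>R (y - z)"] by (simp add: algebra_simps)
  qed
  ultimately have "- (grad q z \<bullet> (y - z)) \<le> h y - h z"
    by (rule derivative_le_of_secant_bound)
  then show ?thesis by simp
qed

lemma convex_on_weighted_l1:
  fixes c :: "'n::finite \<Rightarrow> real"
  assumes "\<And>i. 0 \<le> c i"
  shows "convex_on UNIV (\<lambda>z::real^'n. \<Sum>i\<in>UNIV. c i * \<bar>z $ i\<bar>)"
proof (rule convex_onI)
  fix t :: real and u v :: "real^'n" assume t: "0 < t" "t < 1"
  have "c i * \<bar>((1 - t) *\<^sub>R u + t *\<^sub>R v) $ i\<bar> \<le> (1 - t) * (c i * \<bar>u $ i\<bar>) + t * (c i * \<bar>v $ i\<bar>)" for i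
  proof -
    have "\<bar>((1 - t) *\<^sub>R u + t *\<^sub>R v) $ i\<bar> \<le> (1 - t) * \<bar>u $ i\<bar> + t * \<bar>v $ i\<bar>"
      using abs_triangle_ineq[of "(1 - t) * u $ i" "t * v $ i"] t by (simp add: abs_mult)
    then show ?thesis
      using mult_left_mono[OF _ assms[of i]] by (fastforce simp: algebra_simps)
  qed
  then show "(\<Sum>i\<in>UNIV. c i * \<bar>((1 - t) *\<^sub>R u + t *\<^sub>R v) $ i\<bar>)
      \<le> (1 - t) * (\<Sum>i\<in>UNIV. c i * \<bar>u $ i\<bar>) + t * (\<Sum>i\<in>UNIV. c i * \<bar>v $ i\<bar>)"
    unfolding sum_distrib_left sum.distrib[symmetric] by (rule sum_mono)
qed simp

text \<open>
  This is the inclusion of - grad q z $ i in c i times the subdifferential of the absolute value at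
  z $ i, in the weaker form that forgets the sign. It results from testing the variational
  inequality with perturbations of the i-th coordinate alone.
\<close>
lemma weighted_l1_minimizer_gradient:
  fixes q :: "real^'n \<Rightarrow> real"
  assumes diff: "q differentiable (at z)" and c: "\<And>i. 0 \<le> c i"
    and min: "\<And>y. q z + (\<Sum>i\<in>UNIV. c i * \<bar>z $ i\<bar>) \<le> q y + (\<Sum>i\<in>UNIV. c i * \<bar>y $ i\<bar>)"
  shows "\<bar>grad q z $ i\<bar> \<le> c i"
    and "z $ i \<noteq> 0 \<Longrightarrow> \<bar>grad q z $ i\<bar> = c i"
proof -
  define v where "v = grad q z $ i"
  have coord: "0 \<le> v * s + c i * (\<bar>z $ i + s\<bar> - \<bar>z $ i\<bar>)" for s
  proof -
    let ?y = "z + axis i s"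
    have "0 \<le> grad q z \<bullet> (?y - z) + (\<Sum>j\<in>UNIV. c j * \<bar>?y $ j\<bar>) - (\<Sum>j\<in>UNIV. c j * \<bar>z $ j\<bar>)"
      by (rule composite_minimizer_variational_inequality[OF diff convex_on_weighted_l1[OF c] min])
    also have "grad q z \<bullet> (?y - z) = v * s"
      by (simp add: inner_axis v_def)
    also have "(\<Sum>j\<in>UNIV. c j * \<bar>?y $ j\<bar>)
        = (\<Sum>j\<in>UNIV. c j * \<bar>z $ j\<bar> + (if j = i then c i * (\<bar>z $ i + s\<bar> - \<bar>z $ i\<bar>) else 0))"
      by (rule sum.cong) (auto simp: axis_def algebra_simps)
    finally show ?thesis
      by (simp add: sum.distrib)
  qed
  \<comment> \<open>Unit steps in both directions bound the modulus; the step to zero gives equality.\<close>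
  have "c i * (\<bar>z $ i + s\<bar> - \<bar>z $ i\<bar>) \<le> c i * \<bar>s\<bar>" for s
    using c[of i] by (intro mult_left_mono) auto
  from this[of 1] this[of "- 1"] coord[of 1] coord[of "- 1"]
  have le: "\<bar>v\<bar> \<le> c i" by auto
  show "\<bar>grad q z $ i\<bar> \<le> c i"
    using le by (simp add: v_def)
  assume nz: "z $ i \<noteq> 0"
  have "c i * \<bar>z $ i\<bar> \<le> - v * z $ i"
    using coord[of "- z $ i"] by simp
  also have "\<dots> \<le> \<bar>v\<bar> * \<bar>z $ i\<bar>"
    using abs_ge_self[of "- v * z $ i"] by (simp add: abs_mult)
  finally have "c i \<le> \<bar>v\<bar>" using nz by simp
  then show "\<bar>grad q z $ i\<bar> = c i"
    using le by (simp add: v_def)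
qed

section \<open>The concave penalty\<close>

text \<open>
  Concavity of the power function, obtained from weighted arithmetic-geometric means applied to
  a and b with weights 1 - p and p, after multiplication by a powr (p - 1).
\<close>
lemma powr_le_tangent:
  fixes a b p :: real
  assumes "0 < p" "p < 1" "0 < a" "0 < b"
  shows "b powr p \<le> a powr p + p * a powr (p - 1) * (b - a)"
proof -
  have eq: "a powr (p - 1) * a = a powr p"
    using assms powr_add[of a "p - 1" 1] by simp
  have "b powr p = a powr (p - 1) * (b powr p * a powr (1 - p))"
    using assms powr_add[of a "p - 1" "1 - p"] by simp
  also have "\<dots> \<le> a powr (p - 1) * (p * b + (1 - p) * a)"
    using Youngs_inequality_0[of p "1 - p" b a] assms by (intro mult_left_mono) auto
  also have "\<dots> = a powr (p - 1) * a + p * a powr (p - 1) * (b - a)"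
    by (simp add: algebra_simps)
  finally show ?thesis using eq by simp
qed

text \<open>
  The threshold inverts the strictly decreasing map s \<open>\<mapsto>\<close> lam * p * s powr (p - 1),
  the weight as a function of the smoothed modulus. It is used in both directions: a small smoothed
  modulus makes the weight exceed a gradient bound, and a gradient bounded by the weight limits the
  smoothing parameter.
\<close>
lemma less_threshold_iff:
  fixes s g p lam :: real
  assumes "p < 1" "0 < p" "0 < lam" "0 < s" "0 < g"
  shows "s < (p * lam / g) powr (1 / (1 - p)) \<longleftrightarrow> g < lam * (p * s powr (p - 1))"
proof -
  let ?A = "p * lam / g"
  have A: "0 < ?A" using assms by simp
  have "s < ?A powr (1 / (1 - p)) \<longleftrightarrow> s powr (1 - p) < (?A powr (1 / (1 - p))) powr (1 - p)"
    using assms by (metis A diff_gt_0_iff_gt less_eq_real_def not_less powr_less_mono2 powr_gt_zero)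
  also have "(?A powr (1 / (1 - p))) powr (1 - p) = ?A"
    using assms A by (simp add: powr_powr)
  also have "s powr (1 - p) < ?A \<longleftrightarrow> g < lam * p / s powr (1 - p)"
    using assms by (simp add: field_simps)
  also have "lam * p / s powr (1 - p) = lam * (p * s powr (p - 1))"
    using powr_minus_divide[of s "1 - p"] by simp
  finally show ?thesis .
qed

text \<open>
  The weight function is inverted with strict inequalities only: any s slightly below e has a
  strictly larger weight, which eventually dominates g m / lam, so s is eventually below the
  threshold. Replacing y by max y 0 before choosing s keeps s positive, where the inversion is valid.
\<close>
lemma eps_le_liminf_threshold:
  fixes g :: "nat \<Rightarrow> real"
  assumes "0 < p" "p < 1" "0 < lam" "0 < e" and g: "\<And>m. 0 \<le> g m"
    and limsup: "limsup (\<lambda>m. ereal (g m / lam)) \<le> ereal (p * e powr (p - 1))"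
  shows "ereal e \<le> liminf (\<lambda>m. eps_threshold p lam (g m))"
  unfolding le_Liminf_iff
proof (intro allI impI)
  fix y :: ereal assume y: "y < ereal e"
  have "max y 0 < ereal e" using y assms by simp
  then obtain s where s: "max y 0 < ereal s" "s < e"
    using ereal_dense2 by (metis less_ereal.simps(1))
  have s0: "0 < s" using s(1) by (simp add: zero_ereal_def)
  have "p * e powr (p - 1) < p * s powr (p - 1)"
    using powr_less_mono2_neg[of "p - 1" s e] s s0 assms by simp
  then have "limsup (\<lambda>m. ereal (g m / lam)) < ereal (p * s powr (p - 1))"
    using limsup by (simp add: le_less_trans)
  then have "\<forall>\<^sub>F m in sequentially. ereal (g m / lam) < ereal (p * s powr (p - 1))"
    by (rule Limsup_lessD)
  then show "\<forall>\<^sub>F m in sequentially. y < eps_threshold p lam (g m)"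
  proof eventually_elim
    case (elim m)
    show ?case
    proof (cases "g m = 0")
      case True
      then show ?thesis using y by (cases y) (auto simp: eps_threshold_def)
    next
      case False
      then have "s < (p * lam / g m) powr (1 / (1 - p))"
        using less_threshold_iff[of p lam s "g m"] g[of m] elim assms s0 by (simp add: field_simps)
      moreover have "y < ereal s" using s by simp
      ultimately show ?thesis using False by (simp add: eps_threshold_def less_trans)
    qed
  qed
qed

section \<open>Descent and first-order optimality along a run\<close>

locale irl1_smart =
  fixes f :: "real^'n \<Rightarrow> real"
    and Q :: "nat \<Rightarrow> real^'n \<Rightarrow> real"
    and x eps :: "nat \<Rightarrow> real^'n"
    and p lam mu Lf M L :: real
  assumes p: "0 < p" "p < 1" and lam: "0 < lam" and mu: "0 < mu" "mu < 1"
    and f_lip: "lipschitz_differentiable Lf f"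
    and level_bounded:
      "bounded {z. lp_objective p lam f z \<le> lp_objective_eps p lam f (x 0) (eps 0)}"
    and grad_model: "\<And>k. grad (Q k) (x k) = grad f (x k)"
    and Q_strong: "\<And>k. strongly_convex M (Q k)" and M: "Lf / 2 < M"
    and Q_lip: "\<And>k. lipschitz_differentiable L (Q k)"
    and run: "irl1_smart_run p lam mu Q x eps"
begin

abbreviation w :: "nat \<Rightarrow> 'n \<Rightarrow> real" where
  "w k i \<equiv> irl1_weight p (x k) (eps k) i"

abbreviation energy :: "nat \<Rightarrow> real" where
  "energy k \<equiv> lp_objective_eps p lam f (x k) (eps k)"

lemma eps_pos: "0 < eps k $ i"
  using run by (simp add: irl1_smart_run_def)

lemma eps_update:
  "x (Suc k) $ i = 0 \<Longrightarrow> eps (Suc k) $ i = eps k $ i"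
  "x (Suc k) $ i \<noteq> 0 \<Longrightarrow> eps (Suc k) $ i \<le> mu * eps k $ i"
  using run unfolding irl1_smart_run_def by metis+

lemma eps_Suc_le: "eps (Suc k) $ i \<le> eps k $ i"
proof (cases "x (Suc k) $ i = 0")
  case False
  then have "eps (Suc k) $ i \<le> mu * eps k $ i" by (rule eps_update(2))
  also have "\<dots> \<le> eps k $ i" using mu eps_pos[of k i] by simp
  finally show ?thesis .
qed (simp add: eps_update(1))

lemma weight_nonneg: "0 \<le> lam * w k i"
  using p lam by (simp add: irl1_weight_def)

lemma f_diff: "f differentiable (at z)"
  using f_lip by (simp add: lipschitz_differentiable_def)

lemma Q_diff: "Q k differentiable (at z)"
  using Q_lip by (simp add: lipschitz_differentiable_def)

lemma iterate_minimizes: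
  "Q k (x (Suc k)) + (\<Sum>i\<in>UNIV. lam * w k i * \<bar>x (Suc k) $ i\<bar>)
     \<le> Q k y + (\<Sum>i\<in>UNIV. lam * w k i * \<bar>y $ i\<bar>)"
  using run unfolding irl1_smart_run_def is_arg_min_linorder
  by (simp add: sum_distrib_left mult.assoc)

lemmas gradient_le_weight =
  weighted_l1_minimizer_gradient(1)[OF Q_diff weight_nonneg iterate_minimizes]

lemmas gradient_eq_weight =
  weighted_l1_minimizer_gradient(2)[OF Q_diff weight_nonneg iterate_minimizes]

text \<open>
  Links the stationarity condition, which concerns the model at the new point, to the gradient of
  f at the old point, where model and objective agree to first order.
\<close>
lemma gradient_drift:
  "\<bar>grad (Q k) (x (Suc k)) $ i - grad f (x k) $ i\<bar> \<le> L * norm (x (Suc k) - x k)"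
proof -
  have "\<bar>(grad (Q k) (x (Suc k)) - grad (Q k) (x k)) $ i\<bar> \<le> norm (grad (Q k) (x (Suc k)) - grad (Q k) (x k))"
    by (rule component_le_norm_cart)
  also have "\<dots> \<le> L * norm (x (Suc k) - x k)"
    using Q_lip[of k] by (auto simp: lipschitz_differentiable_def lipschitz_on_def dist_norm)
  finally show ?thesis by (simp add: grad_model)
qed

text \<open>
  Adding the strong convexity inequalities of the model based at the two endpoints, together with
  the optimality of the new point, bounds the linear term of f by the decrease of the weighted l1
  norm minus M times the squared step. The descent lemma for f costs at most Lf/2 times the squared
  step, and
  concavity turns the change of the weighted l1 norm into a bound for the penalty. The update of eps
  only lowers the penalty further.
\<close>
lemma sufficient_decrease:
  "energy (Suc k) + (M - Lf / 2) * (norm (x (Suc k) - x k))\<^sup>2 \<le> energy k"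
proof -
  let ?z = "x (Suc k)"
  let ?l1 = "\<lambda>y::real^'n. \<Sum>i\<in>UNIV. lam * w k i * \<bar>y $ i\<bar>"
  let ?N = "(norm (?z - x k))\<^sup>2"
  have "0 \<le> grad (Q k) ?z \<bullet> (x k - ?z) + ?l1 (x k) - ?l1 ?z"
    by (rule composite_minimizer_variational_inequality[OF Q_diff
          convex_on_weighted_l1[OF weight_nonneg] iterate_minimizes])
  moreover have "Q k ?z + grad (Q k) ?z \<bullet> (x k - ?z) + M / 2 * ?N \<le> Q k (x k)"
    using strongly_convex_gradient_lower_bound[OF Q_strong Q_diff, of k ?z "x k"]
    by (simp only: norm_minus_commute)
  moreover have "Q k (x k) + grad f (x k) \<bullet> (?z - x k) + M / 2 * ?N \<le> Q k ?z"
    using strongly_convex_gradient_lower_bound[OF Q_strong Q_diff, of k "x k" ?z]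
    by (simp only: grad_model)
  moreover have "f ?z \<le> f (x k) + grad f (x k) \<bullet> (?z - x k) + Lf / 2 * ?N"
    by (rule lipschitz_gradient_upper_bound[OF f_lip])
  moreover have "lam * (\<Sum>i\<in>UNIV. (\<bar>?z $ i\<bar> + eps (Suc k) $ i) powr p)
      \<le> lam * (\<Sum>i\<in>UNIV. (\<bar>x k $ i\<bar> + eps k $ i) powr p) + ?l1 ?z - ?l1 (x k)"
  proof -
    have "(\<bar>?z $ i\<bar> + eps (Suc k) $ i) powr p
        \<le> (\<bar>x k $ i\<bar> + eps k $ i) powr p + w k i * (\<bar>?z $ i\<bar> - \<bar>x k $ i\<bar>)" for i
    proof -
      have "(\<bar>?z $ i\<bar> + eps (Suc k) $ i) powr p \<le> (\<bar>?z $ i\<bar> + eps k $ i) powr p"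
        using p eps_Suc_le[of k i] eps_pos[of "Suc k" i] by (intro powr_mono2) auto
      also have "\<dots> \<le> (\<bar>x k $ i\<bar> + eps k $ i) powr p
          + w k i * ((\<bar>?z $ i\<bar> + eps k $ i) - (\<bar>x k $ i\<bar> + eps k $ i))"
        unfolding irl1_weight_def using p eps_pos[of k i]
        by (intro powr_le_tangent) (auto intro: add_nonneg_pos)
      finally show ?thesis by simp
    qed
    then have "lam * (\<Sum>i\<in>UNIV. (\<bar>?z $ i\<bar> + eps (Suc k) $ i) powr p)
        \<le> lam * (\<Sum>i\<in>UNIV. (\<bar>x k $ i\<bar> + eps k $ i) powr p + w k i * (\<bar>?z $ i\<bar> - \<bar>x k $ i\<bar>))"
      using lam by (intro mult_left_mono sum_mono) auto
    then show ?thesis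
      by (simp add: sum.distrib sum_subtractf sum_distrib_left algebra_simps)
  qed
  ultimately show ?thesis
    unfolding lp_objective_eps_def by (simp add: algebra_simps)
qed

lemma energy_decseq: "decseq energy"
proof (rule decseq_SucI)
  fix k
  have "0 \<le> (M - Lf / 2) * (norm (x (Suc k) - x k))\<^sup>2" using M by simp
  then show "energy (Suc k) \<le> energy k" using sufficient_decrease[of k] by linarith
qed

lemma iterates_bounded: "bounded (range x)"
proof (rule bounded_subset[OF level_bounded])
  have "lp_objective p lam f (x k) \<le> energy 0" for k
  proof -
    have "lp_objective p lam f (x k) \<le> energy k"
      unfolding lp_objective_def lp_objective_eps_def using p lam eps_pos
      by (auto intro!: mult_left_mono sum_mono powr_mono2 simp: less_imp_le)
    also have "\<dots> \<le> energy 0" using energy_decseq by (simp add: decseq_def)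
    finally show ?thesis .
  qed
  then show "range x \<subseteq> {z. lp_objective p lam f z \<le> energy 0}" by auto
qed

text \<open>
  The energy is bounded below on the bounded set of iterates, hence converges, and its consecutive
  differences control the squared steps.
\<close>
lemma steps_vanish: "(\<lambda>k. norm (x (Suc k) - x k)) \<longlonglongrightarrow> 0"
proof -
  have "continuous_on (closure (range x)) f"
    using f_diff by (intro continuous_at_imp_continuous_on ballI differentiable_imp_continuous_within)
  then have "bounded (f ` closure (range x))"
    using iterates_bounded by (intro compact_imp_bounded compact_continuous_image) auto
  then obtain B where "\<And>y. y \<in> closure (range x) \<Longrightarrow> \<bar>f y\<bar> \<le> B"
    by (auto simp: bounded_iff)
  then have "\<bar>f (x k)\<bar> \<le> B" for k
    using closure_subset[of "range x"] by blast
  moreover have "f (x k) \<le> energy k" for k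
    unfolding lp_objective_eps_def using lam by (simp add: sum_nonneg)
  ultimately have "\<forall>k. - B \<le> energy k" by (smt (verit))
  then obtain E where E: "energy \<longlonglongrightarrow> E"
    using decseq_convergent[OF energy_decseq] by metis
  have "(\<lambda>k. (energy k - energy (Suc k)) / (M - Lf / 2)) \<longlonglongrightarrow> (E - E) / (M - Lf / 2)"
    using M E by (intro tendsto_intros LIMSEQ_Suc) auto
  then have "(\<lambda>k. (energy k - energy (Suc k)) / (M - Lf / 2)) \<longlonglongrightarrow> 0" by simp
  then have "(\<lambda>k. (norm (x (Suc k) - x k))\<^sup>2) \<longlonglongrightarrow> 0"
  proof (rule tendsto_sandwich[rotated 3])
    have "(norm (x (Suc k) - x k))\<^sup>2 \<le> (energy k - energy (Suc k)) / (M - Lf / 2)" for k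
      using sufficient_decrease[of k] M by (simp add: field_simps)
    then show "\<forall>\<^sub>F k in sequentially. (norm (x (Suc k) - x k))\<^sup>2
        \<le> (energy k - energy (Suc k)) / (M - Lf / 2)" by simp
  qed auto
  then show ?thesis by (simp add: power_tendsto_0_iff)
qed

lemma model_gradient_bounded:
  obtains C where "0 < C" "\<And>k i. \<bar>grad (Q k) (x (Suc k)) $ i\<bar> \<le> C"
proof -
  have "continuous_on (closure (range x)) (grad f)"
    using f_lip unfolding lipschitz_differentiable_def
    by (meson continuous_on_subset lipschitz_on_continuous_on subset_UNIV)
  then have "bounded (grad f ` closure (range x))"
    using iterates_bounded by (intro compact_imp_bounded compact_continuous_image) auto
  then obtain B where "\<And>y. y \<in> closure (range x) \<Longrightarrow> norm (grad f y) \<le> B"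
    by (auto simp: bounded_iff)
  then have B: "norm (grad f (x k)) \<le> B" for k
    using closure_subset[of "range x"] by blast
  obtain S where S: "0 < S" "\<And>k. norm (x (Suc k) - x k) \<le> S"
    using Bseq_eq_bounded convergent_imp_Bseq[OF convergentI[OF steps_vanish]] by (auto elim!: BseqE)
  have L: "0 \<le> L"
    using Q_lip by (auto simp: lipschitz_differentiable_def lipschitz_on_def)
  have "\<bar>grad (Q k) (x (Suc k)) $ i\<bar> \<le> \<bar>B\<bar> + L * S + 1" for k i
  proof -
    have "\<bar>grad f (x k) $ i\<bar> \<le> B"
      using component_le_norm_cart[of "grad f (x k)" i] B[of k] by linarith
    moreover have "L * norm (x (Suc k) - x k) \<le> L * S"
      using S L by (intro mult_left_mono)
    ultimately show ?thesis
      using gradient_drift[of k i] by linarith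
  qed
  moreover have "0 < \<bar>B\<bar> + L * S + 1"
    using L S by (simp add: add_nonneg_pos)
  ultimately show thesis using that by blast
qed

end

section \<open>Each coordinate is either bounded away from zero or eventually zero\<close>

context irl1_smart
begin

text \<open>
  The trap described at the beginning: \<open>absorb\<close> is one turn of the feedback loop, and
  \<open>away\<close> iterates it to show that entering the trap would freeze eps i at a positive value.
\<close>
lemma eps_tendsto_0_imp_iterates_away_from_0:
  assumes "(\<lambda>k. eps k $ i) \<longlonglongrightarrow> 0"
  shows "0 < liminf (\<lambda>k. ereal \<bar>x k $ i\<bar>)"
proof -
  obtain C where C: "0 < C" "\<And>k i. \<bar>grad (Q k) (x (Suc k)) $ i\<bar> \<le> C"
    by (rule model_gradient_bounded) blast
  define \<delta> where "\<delta> = (p * lam / C) powr (1 / (1 - p))"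
  have \<delta>: "0 < \<delta>" using p lam C by (simp add: \<delta>_def)
  have absorb: "x (Suc k) $ i = 0" if "\<bar>x k $ i\<bar> + eps k $ i < \<delta>" for k
  proof (rule ccontr)
    assume "x (Suc k) $ i \<noteq> 0"
    then have "lam * w k i \<le> C"
      using gradient_eq_weight C(2)[of k i] by simp
    moreover have "C < lam * w k i"
      unfolding irl1_weight_def
      using that less_threshold_iff[of p lam "\<bar>x k $ i\<bar> + eps k $ i" C] p lam C eps_pos[of k i]
      by (simp add: \<delta>_def add_nonneg_pos)
    ultimately show False by simp
  qed
  have away: "\<delta> \<le> \<bar>x k $ i\<bar> + eps k $ i" for k
  proof (rule ccontr)
    assume "\<not> ?thesis"
    then have start: "\<bar>x k $ i\<bar> + eps k $ i < \<delta>" by simp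
    have "\<bar>x (k + n) $ i\<bar> + eps (k + n) $ i < \<delta> \<and> eps (k + n) $ i = eps k $ i" for n
    proof (induction n)
      case (Suc n)
      then have "x (Suc (k + n)) $ i = 0" using absorb by blast
      with Suc eps_update(1)[OF this] show ?case by auto
    qed (use start in simp)
    then have "(\<lambda>n. eps (n + k) $ i) = (\<lambda>n. eps k $ i)"
      by (simp add: add.commute)
    moreover have "(\<lambda>n. eps (n + k) $ i) \<longlonglongrightarrow> 0"
      using assms by (rule LIMSEQ_ignore_initial_segment)
    ultimately show False
      using eps_pos[of k i] by (simp add: LIMSEQ_const_iff)
  qed
  have "\<forall>\<^sub>F k in sequentially. eps k $ i < \<delta> / 2"
    using assms \<delta> by (intro order_tendstoD) auto
  then have "\<forall>\<^sub>F k in sequentially. ereal (\<delta> / 2) \<le> ereal \<bar>x k $ i\<bar>"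
  proof eventually_elim
    case (elim k)
    then show ?case using away[of k] by simp
  qed
  then have "ereal (\<delta> / 2) \<le> liminf (\<lambda>k. ereal \<bar>x k $ i\<bar>)"
    by (rule Liminf_bounded)
  moreover have "0 < ereal (\<delta> / 2)" using \<delta> by simp
  ultimately show ?thesis by (rule less_le_trans[rotated])
qed

text \<open>
  A reduction by the factor mu from a value below l / mu would go below the limit l, whereas the
  sequence decreases to l; hence late iterations are not reductions.
\<close>
lemma eps_positive_limit_imp_eventually_zero:
  assumes l: "0 < l" "(\<lambda>k. eps k $ i) \<longlonglongrightarrow> l"
  shows "\<exists>K. (\<forall>k\<ge>K. eps k $ i = eps K $ i) \<and> (\<forall>k>K. x k $ i = 0)"
proof -
  have "decseq (\<lambda>k. eps k $ i)" by (rule decseq_SucI) (rule eps_Suc_le)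
  then have ge: "l \<le> eps k $ i" for k using l(2) by (rule decseq_ge)
  have "l < l / mu" using l mu by (simp add: field_simps)
  then have "\<forall>\<^sub>F k in sequentially. eps k $ i < l / mu"
    using l(2) by (rule order_tendstoD(2)[rotated])
  then obtain K where K: "\<And>k. k \<ge> K \<Longrightarrow> eps k $ i < l / mu"
    by (auto simp: eventually_sequentially)
  have zero: "x (Suc k) $ i = 0" if "k \<ge> K" for k
  proof (rule ccontr)
    assume "x (Suc k) $ i \<noteq> 0"
    then have "eps (Suc k) $ i \<le> mu * eps k $ i" by (rule eps_update(2))
    also have "\<dots> < l" using K[OF that] mu by (simp add: field_simps)
    finally show False using ge[of "Suc k"] by simp
  qed
  have "eps k $ i = eps K $ i" if "k \<ge> K" for k
    using that by (induction k rule: dec_induct) (auto simp: eps_update(1)[OF zero])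
  moreover have "x k $ i = 0" if "k > K" for k
    using zero[of "k - 1"] that by simp
  ultimately show ?thesis by blast
qed

text \<open>
  The index K itself is excluded: only the update that produces eps k (for k > K) carries
  information about x k.
\<close>
lemma eps_fixed_imp_zero:
  assumes "\<forall>k\<ge>K. eps k $ i = eps K $ i" and "k > K"
  shows "x k $ i = 0"
proof (rule ccontr)
  obtain j where j: "k = Suc j" "j \<ge> K" using assms(2) by (cases k) auto
  assume "x k $ i \<noteq> 0"
  then have "eps K $ i \<le> mu * eps K $ i"
    using eps_update(2)[of j i] assms(1) j by (metis le_SucI)
  then show False using mu eps_pos[of K i] by simp
qed

text \<open>
  After K the coordinate is zero, so its weight is constant, and it bounds the partial derivative
  of f up to the drift caused by a step. The drift vanishes in the limit.
\<close>
lemma eps_fixed_imp_gradient_limsup: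
  assumes "\<forall>k\<ge>K. eps k $ i = eps K $ i"
  shows "limsup (\<lambda>m. ereal (\<bar>grad f (x m) $ i\<bar> / lam)) \<le> ereal (p * (eps K $ i) powr (p - 1))"
proof -
  let ?W = "p * (eps K $ i) powr (p - 1)"
  have bound: "\<bar>grad f (x m) $ i\<bar> / lam \<le> ?W + L * norm (x (Suc m) - x m) / lam" if "m > K" for m
  proof -
    have "eps m $ i = eps K $ i" using assms that by (meson less_imp_le)
    then have weight: "w m i = ?W"
      using eps_fixed_imp_zero[OF assms that] eps_pos[of K i] by (simp add: irl1_weight_def)
    then have "\<bar>grad f (x m) $ i\<bar> \<le> lam * ?W + L * norm (x (Suc m) - x m)"
      using gradient_drift[of m i] gradient_le_weight[of m i, unfolded weight] by linarith
    then show ?thesis using lam by (simp add: field_simps)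
  qed
  have "(\<lambda>m. ?W + L * norm (x (Suc m) - x m) / lam) \<longlonglongrightarrow> ?W + L * 0 / lam"
    using steps_vanish lam by (intro tendsto_intros) auto
  then have "limsup (\<lambda>m. ereal (?W + L * norm (x (Suc m) - x m) / lam)) = ereal ?W"
    by (intro lim_imp_Limsup) auto
  moreover have "limsup (\<lambda>m. ereal (\<bar>grad f (x m) $ i\<bar> / lam))
      \<le> limsup (\<lambda>m. ereal (?W + L * norm (x (Suc m) - x m) / lam))"
    using bound by (intro Limsup_mono eventually_mono[OF eventually_gt_at_top[of K]]) simp
  ultimately show ?thesis by simp
qed

end

section \<open>Limits of the iterates and of the smoothing parameters\<close>

theorem theorem2p8:
  fixes f :: "real^'n \<Rightarrow> real"
    and Q :: "nat \<Rightarrow> real^'n \<Rightarrow> real"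
    and x eps :: "nat \<Rightarrow> real^'n"
    and p lam mu Lf M L :: real
  assumes "0 < p" and "p < 1" and "0 < lam" and "0 < mu" and "mu < 1"
    and "continuously_differentiable f"
    and "lipschitz_differentiable Lf f"
    and "bounded {z. lp_objective p lam f z \<le> lp_objective_eps p lam f (x 0) (eps 0)}"
    and "\<And>k. grad (Q k) (x k) = grad f (x k)"
    and "\<And>k. strongly_convex M (Q k)" and "Lf / 2 < M" and "0 < M"
    and "\<And>k. lipschitz_differentiable L (Q k)" and "0 < L"
    and "irl1_smart_run p lam mu Q x eps"
  shows "(\<forall>i. (\<lambda>k. eps k $ i) \<longlonglongrightarrow> 0 \<longrightarrow> 0 < liminf (\<lambda>k. ereal \<bar>x k $ i\<bar>)) \<and>
    (\<forall>i. (\<exists>l>0. (\<lambda>k. eps k $ i) \<longlonglongrightarrow> l) \<longrightarrow>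
       (\<exists>kt. \<forall>k\<ge>kt. eps k $ i = eps kt $ i) \<and> (\<lambda>k. x k $ i) \<longlonglongrightarrow> 0) \<and>
    (\<forall>i kt. (\<forall>k\<ge>kt. eps k $ i = eps kt $ i) \<longrightarrow>
       (\<forall>k>kt. ereal (irl1_weight p (x k) (eps k) i)
                 \<ge> limsup (\<lambda>m. ereal (\<bar>grad f (x m) $ i\<bar> / lam))) \<and>
       (x kt $ i = 0 \<longrightarrow>
          ereal (irl1_weight p (x kt) (eps kt) i)
            \<ge> limsup (\<lambda>m. ereal (\<bar>grad f (x m) $ i\<bar> / lam))) \<and>
       ereal (eps kt $ i) \<le> liminf (\<lambda>m. eps_threshold p lam \<bar>grad f (x m) $ i\<bar>))"
proof -
  interpret irl1_smart f Q x eps p lam mu Lf M L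
    using assms by unfold_locales
  show ?thesis
  proof (intro conjI allI impI)
    fix i assume "(\<lambda>k. eps k $ i) \<longlonglongrightarrow> 0"
    then show "0 < liminf (\<lambda>k. ereal \<bar>x k $ i\<bar>)"
      by (rule eps_tendsto_0_imp_iterates_away_from_0)
  next
    fix i assume "\<exists>l>0. (\<lambda>k. eps k $ i) \<longlonglongrightarrow> l"
    then obtain K where K: "\<forall>k\<ge>K. eps k $ i = eps K $ i" "\<forall>k>K. x k $ i = 0"
      using eps_positive_limit_imp_eventually_zero by blast
    from K(1) show "\<exists>kt. \<forall>k\<ge>kt. eps k $ i = eps kt $ i" by blast
    have "\<forall>\<^sub>F k in sequentially. x k $ i = 0"
      using K(2) by (auto intro: eventually_mono[OF eventually_gt_at_top[of K]])
    then show "(\<lambda>k. x k $ i) \<longlonglongrightarrow> 0"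
      by (rule tendsto_eventually)
  next
    fix i kt assume fixed: "\<forall>k\<ge>kt. eps k $ i = eps kt $ i"
    note limsup = eps_fixed_imp_gradient_limsup[OF fixed]
    show "limsup (\<lambda>m. ereal (\<bar>grad f (x m) $ i\<bar> / lam)) \<le> ereal (w k i)" if "k > kt" for k
    proof -
      have "eps k $ i = eps kt $ i" using fixed that by (meson less_imp_le)
      then show ?thesis
        using limsup eps_fixed_imp_zero[OF fixed that] eps_pos[of kt i] by (simp add: irl1_weight_def)
    qed
    show "limsup (\<lambda>m. ereal (\<bar>grad f (x m) $ i\<bar> / lam)) \<le> ereal (w kt i)" if "x kt $ i = 0"
      using limsup that eps_pos[of kt i] by (simp add: irl1_weight_def)
    show "ereal (eps kt $ i) \<le> liminf (\<lambda>m. eps_threshold p lam \<bar>grad f (x m) $ i\<bar>)"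
      using eps_le_liminf_threshold[OF p lam eps_pos abs_ge_zero limsup] .
  qed
qed

end
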